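(* Let $c>1$, $\bar c=(c+1)/(c-1)$, and suppose $\kappa(\bar c)>0$. Let $\widehat\beta$ be the Lasso estimator with penalty level $\lambda>0$, $\widehat T=\operatorname{support}(\widehat\beta)$ and $\widehat m=|\widehat T\setminus T|$. Put $$L_n=\Big[\frac{2\bar c}{\kappa(\bar c)}+3(\bar c+1)\frac{n c_s}{\lambda\sqrt s}\Big]^2,\qquad \mathcal M=\{m\in\mathbb N:\ m> s\,\phi(m\wedge n)\cdot 2L_n\}.$$ Then the event $\lambda\ge c\,n\|S\|_\infty$ implies that $$\widehat m\le s\cdot\Big[\min_{m\in\mathcal M}\phi(m\wedge n)\Big]\cdot L_n .$$
   Context: Setting. For each $n$ the data satisfy $y_i=f_i+\epsilon_i$, $f_i=f(z_i)$, $i=1,\dots,n$, with $\epsilon_i$ i.i.d. $N(0,\sigma^2)$, $\sigma>0$, and fixed (nonrandom) $z_i$. The vectors $x_i=P(z_i)\in\mathbb R^p$ are fixed technical regressors ($p$ may exceed $n$) normalized so that $\mathbb E_n[x_{\bullet j}^2]=1$ for $j=1,\dots,p$, where $\mathbb E_n[g_\bullet]=\frac1n\sum_{i=1}^n g_i$. Write $\widehat Q(\beta)=\mathbb E_n[(y_\bullet-x_\bullet'\beta)^2]$ and $\|\delta\|_{2,n}=(\mathbb E_n[(x_\bullet'\delta)^2])^{1/2}$; $\|\cdot\|,\|\cdot\|_1,\|\cdot\|_\infty$ are the $\ell_2,\ell_1,\ell_\infty$ norms and $\|\cdot\|_0$ counts nonzero components. $a\wedge b=\min\{a,b\}$. Oracle.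 $c_k^2=\min_{\|\beta\|_0\le k}\mathbb E_n[(f_\bullet-x_\bullet'\beta)^2]$, $c_k\ge0$; $s$ is the smallest minimizer of $c_k^2+\sigma^2k/n$ over integers $0\le k\le p\wedge n$, and $s\ge1$; $\beta_0$ is a fixed minimizer of $\mathbb E_n[(f_\bullet-x_\bullet'\beta)^2]$ over $\|\beta\|_0\le s$; $T=\operatorname{support}(\beta_0)$, $|T|=s$; $c_s$ is $c_k$ at $k=s$. $T^c$ is the complement of $T$ in $\{1,\dots,p\}$. For $A\subset\{1,\dots,p\}$, $\delta_A$ has components $\delta_j$ for $j\in A$ and $0$ otherwise. Score: $S=2\mathbb E_n[x_\bullet\epsilon_\bullet]$. Lasso: $\widehat\beta\in\arg\min_{\beta\in\mathbb R^p}\widehat Q(\beta)+\frac\lambda n\|\beta\|_1$ (if not unique, any solution with minimum support). Restricted eigenvalue: $\kappa(C)=\min\{\sqrt s\,\|\delta\|_{2,n}/\|\delta_T\|_1:\ \|\delta_{T^c}\|_1\le C\|\delta_T\|_1,\ \delta\ne0\}$. Restricted sparse eigenvalue: $\phi(m)=\max\{\|\delta\|_{2,n}^2/\|\delta\|^2:\ \|\delta_{T^c}\|_0\le m,\ \delta\neq0\}$. *)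

theory Defs
  imports "HOL-Probability.Probability"
begin

text \<open>
  Observations are indexed by a finite type \<open>'n\<close> (so \<open>n = CARD('n)\<close>) and regressors by a
  finite type \<open>'p\<close> (so \<open>p = CARD('p)\<close>, unrelated to \<open>n\<close>).
\<close>

definition En :: "('n::finite \<Rightarrow> 'a::real_vector) \<Rightarrow> 'a" where
  "En g = (1 / real CARD('n)) *\<^sub>R (\<Sum>i\<in>UNIV. g i)"

definition supp :: "real ^ 'p::finite \<Rightarrow> 'p set" where
  "supp b = {j. b $ j \<noteq> 0}"

definition l0norm :: "real ^ 'p::finite \<Rightarrow> nat" where
  "l0norm b = card (supp b)"

definition l1norm :: "real ^ 'p::finite \<Rightarrow> real" where
  "l1norm b = (\<Sum>j\<in>UNIV. \<bar>b $ j\<bar>)"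

definition restr :: "'p::finite set \<Rightarrow> real ^ 'p \<Rightarrow> real ^ 'p" where
  "restr A d = (\<chi> j. if j \<in> A then d $ j else 0)"

definition pred_norm :: "('n::finite \<Rightarrow> real ^ 'p::finite) \<Rightarrow> real ^ 'p \<Rightarrow> real" where
  "pred_norm x d = sqrt (En (\<lambda>i. (x i \<bullet> d)\<^sup>2))"

text \<open>Used both for the observed responses and for the noiseless values of \<open>f\<close>.\<close>

definition Qhat :: "('n::finite \<Rightarrow> real ^ 'p::finite) \<Rightarrow> ('n \<Rightarrow> real) \<Rightarrow> real ^ 'p \<Rightarrow> real" where
  "Qhat x y b = En (\<lambda>i. (y i - x i \<bullet> b)\<^sup>2)"

text \<open>
  The infimum is attained: for each support set of size at most \<open>k\<close> this is a least squares
  problem, and there are finitely many supports.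
\<close>

definition approx_err :: "('n::finite \<Rightarrow> real ^ 'p::finite) \<Rightarrow> ('n \<Rightarrow> real) \<Rightarrow> nat \<Rightarrow> real" where
  "approx_err x f k = sqrt (INF b\<in>{b. l0norm b \<le> k}. Qhat x f b)"

definition oracle_risk ::
  "('n::finite \<Rightarrow> real ^ 'p::finite) \<Rightarrow> ('n \<Rightarrow> real) \<Rightarrow> real \<Rightarrow> nat \<Rightarrow> real" where
  "oracle_risk x f \<sigma> k = (approx_err x f k)\<^sup>2 + \<sigma>\<^sup>2 * real k / real CARD('n)"

definition oracle_dim ::
  "('n::finite \<Rightarrow> real ^ 'p::finite) \<Rightarrow> ('n \<Rightarrow> real) \<Rightarrow> real \<Rightarrow> nat" where
  "oracle_dim x f \<sigma> =
     (LEAST k. is_arg_min (oracle_risk x f \<sigma>) (\<lambda>k. k \<le> min CARD('p) CARD('n)) k)"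

definition score :: "('n::finite \<Rightarrow> real ^ 'p::finite) \<Rightarrow> ('n \<Rightarrow> real) \<Rightarrow> real ^ 'p" where
  "score x e = 2 *\<^sub>R En (\<lambda>i. e i *\<^sub>R x i)"

definition lasso_objective ::
  "('n::finite \<Rightarrow> real ^ 'p::finite) \<Rightarrow> ('n \<Rightarrow> real) \<Rightarrow> real \<Rightarrow> real ^ 'p \<Rightarrow> real" where
  "lasso_objective x y lam b = Qhat x y b + lam / real CARD('n) * l1norm b"

text \<open>Ties among minimizers are broken in favour of a support of least cardinality.\<close>

definition is_lasso ::
  "('n::finite \<Rightarrow> real ^ 'p::finite) \<Rightarrow> ('n \<Rightarrow> real) \<Rightarrow> real \<Rightarrow> real ^ 'p \<Rightarrow> bool" where
  "is_lasso x y lam b \<longleftrightarrow>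
     is_arg_min l0norm (is_arg_min (lasso_objective x y lam) (\<lambda>_. True)) b"

text \<open>
  For nonempty \<open>T\<close> and \<open>C \<ge> 0\<close>, the cone constraint with \<open>\<delta> \<noteq> 0\<close> forces a nonzero denominator,
  and the infimum is attained: the quotient is scale invariant, and the admissible \<open>\<delta>\<close> whose
  restriction to \<open>T\<close> has \<open>l1norm\<close> equal to 1 form a nonempty compact set.
\<close>

definition restricted_eigenvalue ::
  "('n::finite \<Rightarrow> real ^ 'p::finite) \<Rightarrow> 'p set \<Rightarrow> nat \<Rightarrow> real \<Rightarrow> real" where
  "restricted_eigenvalue x T s C =
     Inf {sqrt (real s) * pred_norm x \<delta> / l1norm (restr T \<delta>) | \<delta>.
            l1norm (restr (- T) \<delta>) \<le> C * l1norm (restr T \<delta>) \<and> \<delta> \<noteq> 0}"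

text \<open>
  For nonempty \<open>T\<close> the supremum is attained: the quotient is scale invariant, and the
  admissible unit vectors form a nonempty compact set.
\<close>

definition sparse_eigenvalue ::
  "('n::finite \<Rightarrow> real ^ 'p::finite) \<Rightarrow> 'p set \<Rightarrow> nat \<Rightarrow> real" where
  "sparse_eigenvalue x T m =
     Sup {(pred_norm x \<delta>)\<^sup>2 / (norm \<delta>)\<^sup>2 | \<delta>. l0norm (restr (- T) \<delta>) \<le> m \<and> \<delta> \<noteq> 0}"

end

theory Submission
  imports Defs
begin

text \<open>
  Let \<open>\<delta>\<close> be the estimation error and \<open>v\<close> the sign vector of the Lasso estimate outside \<open>T\<close>.
  Optimality of the Lasso in the direction \<open>v\<close> expresses \<open>\<lambda> mhat / n\<close> as an empirical covariance of
  \<open>x' v\<close> with the residual. Its noise part is at most a fraction \<open>1 / c\<close> of the left-hand side, and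
  the rest is bounded by Cauchy--Schwarz in terms of \<open>c\<^sub>s\<close> and the prediction error, which the basic
  inequality and the restricted eigenvalue control. Hence \<open>mhat \<le> s K L\<close> whenever \<open>K\<close> bounds
  the quadratic form on vectors with the support of \<open>v\<close>.

  One always has \<open>mhat \<le> n\<close>: with more than \<open>n\<close> active regressors the estimate could be moved
  along a null direction of the design, at constant objective value, until a coordinate vanishes.
  If \<open>m \<in> \<M>\<close> and \<open>m < mhat\<close>, cutting the support of \<open>v\<close> into \<open>\<lceil>mhat / m\<rceil> \<le> 2 mhat / m\<close> pieces
  yields \<open>K \<le> (2 mhat / m) \<phi> m\<close>, hence \<open>m \<le> 2 s \<phi> m L\<close>, which \<open>\<M>\<close> excludes.
  Therefore \<open>mhat \<le> m\<close>, and \<open>K = \<phi> (min m n)\<close> is admissible.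
\<close>

section \<open>Empirical means, norms and the expansion of the quadratic loss\<close>

lemma En_real: "En (g :: 'n::finite \<Rightarrow> real) = (\<Sum>i\<in>UNIV. g i) / real CARD('n)"
  by (simp add: En_def)

text \<open>Passing to \<open>L2_set\<close> makes its Cauchy--Schwarz and triangle inequalities
  available for empirical norms.\<close>

lemma sqrt_En_squares:
  "sqrt (En (\<lambda>i::'n::finite. (g i)\<^sup>2)) = L2_set g UNIV / sqrt (real CARD('n))"
  by (simp add: En_real L2_set_def real_sqrt_divide)

lemma abs_En_mult_le:
  fixes g h :: "'n::finite \<Rightarrow> real"
  shows "\<bar>En (\<lambda>i. g i * h i)\<bar> \<le> sqrt (En (\<lambda>i. (g i)\<^sup>2)) * sqrt (En (\<lambda>i. (h i)\<^sup>2))"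
proof -
  have "\<bar>\<Sum>i\<in>UNIV. g i * h i\<bar> \<le> (\<Sum>i\<in>UNIV. \<bar>g i\<bar> * \<bar>h i\<bar>)"
    by (rule order_trans[OF sum_abs]) (simp add: abs_mult)
  also have "\<dots> \<le> L2_set g UNIV * L2_set h UNIV"
    by (rule L2_set_mult_ineq)
  finally show ?thesis
    unfolding sqrt_En_squares by (simp add: En_real divide_right_mono)
qed

lemma pred_norm_nonneg [simp]: "0 \<le> pred_norm x d"
  by (simp add: pred_norm_def En_real sum_nonneg)

lemma pred_norm_power2: "(pred_norm x d)\<^sup>2 = En (\<lambda>i. (x i \<bullet> d)\<^sup>2)"
  by (simp add: pred_norm_def En_real sum_nonneg)

lemma pred_norm_add_le: "pred_norm x (a + b) \<le> pred_norm x a + pred_norm x b"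
  unfolding pred_norm_def sqrt_En_squares inner_add_right
  by (simp add: add_divide_distrib[symmetric] divide_right_mono L2_set_triangle_ineq)

text \<open>Exact second-order expansion of the loss. At the oracle vector it gives the basic
  inequality, at the Lasso estimate the first-order condition.\<close>

lemma Qhat_add:
  "Qhat x y (b + d) = Qhat x y b - 2 * En (\<lambda>i. (y i - x i \<bullet> b) * (x i \<bullet> d)) + (pred_norm x d)\<^sup>2"
proof -
  have "(\<Sum>i\<in>UNIV. (y i - x i \<bullet> (b + d))\<^sup>2) = (\<Sum>i\<in>UNIV. (y i - x i \<bullet> b)\<^sup>2)
      - 2 * (\<Sum>i\<in>UNIV. (y i - x i \<bullet> b) * (x i \<bullet> d)) + (\<Sum>i\<in>UNIV. (x i \<bullet> d)\<^sup>2)"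
    unfolding sum_distrib_left sum_subtractf[symmetric] sum.distrib[symmetric]
    by (rule sum.cong) (auto simp: inner_add_right power2_eq_square algebra_simps)
  then show ?thesis
    unfolding Qhat_def pred_norm_power2 En_real
    by (simp add: add_divide_distrib diff_divide_distrib)
qed

lemma Qhat_nonneg: "0 \<le> Qhat x y b"
  by (simp add: Qhat_def En_real sum_nonneg)

lemma inner_score: "score x e \<bullet> d = 2 * En (\<lambda>i. e i * (x i \<bullet> d))"
  by (simp add: score_def En_def inner_sum_left)

lemma abs_inner_le_infnorm_l1norm: "\<bar>a \<bullet> d\<bar> \<le> infnorm a * l1norm d"
proof -
  have "\<bar>a \<bullet> d\<bar> \<le> (\<Sum>j\<in>UNIV. \<bar>a $ j\<bar> * \<bar>d $ j\<bar>)"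
    unfolding inner_vec_def by (rule order_trans[OF sum_abs]) (simp add: abs_mult)
  also have "\<dots> \<le> (\<Sum>j\<in>UNIV. infnorm a * \<bar>d $ j\<bar>)"
    by (intro sum_mono mult_right_mono component_le_infnorm_cart) auto
  finally show ?thesis by (simp add: l1norm_def sum_distrib_left)
qed

lemma l1norm_nonneg [simp]: "0 \<le> l1norm d"
  by (simp add: l1norm_def sum_nonneg)

lemma l1norm_restr: "l1norm (restr A d) = (\<Sum>j\<in>A. \<bar>d $ j\<bar>)"
  unfolding l1norm_def restr_def by (rule sum.mono_neutral_cong_right) auto

lemma l1norm_split: "l1norm d = l1norm (restr A d) + l1norm (restr (- A) d)"
proof -
  have "l1norm d = (\<Sum>j\<in>A \<union> - A. \<bar>d $ j\<bar>)" by (simp add: l1norm_def)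
  also have "\<dots> = l1norm (restr A d) + l1norm (restr (- A) d)"
    by (subst sum.union_disjoint) (auto simp: l1norm_restr)
  finally show ?thesis .
qed

lemma l0norm_0 [simp]: "l0norm 0 = 0"
  by (simp add: l0norm_def supp_def)

lemma l0norm_eq_0_iff: "l0norm b = 0 \<longleftrightarrow> b = 0"
  by (auto simp: l0norm_def supp_def vec_eq_iff)

lemma supp_restr: "supp (restr A d) = supp d \<inter> A"
  by (auto simp: supp_def restr_def)

lemma restr_add_restr: "restr A d + restr (- A) d = d"
  by (simp add: restr_def vec_eq_iff)

lemma norm_restr_power2:
  "(norm (restr A d))\<^sup>2 + (norm (restr (- A) d))\<^sup>2 = (norm d)\<^sup>2"
  unfolding power2_norm_eq_inner inner_vec_def sum.distrib[symmetric]
  by (rule sum.cong) (auto simp: restr_def)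

section \<open>Sparse and restricted eigenvalues\<close>

text \<open>By Cauchy--Schwarz each quotient is at most the empirical mean of
  \<open>(norm (x i))\<^sup>2\<close>. Hence the \<open>Sup\<close> is a genuine supremum as soon as
  the set is nonempty.\<close>

lemma sparse_eigenvalue_bdd:
  "bdd_above {(pred_norm x \<delta>)\<^sup>2 / (norm \<delta>)\<^sup>2 | \<delta>. l0norm (restr (- T) \<delta>) \<le> m \<and> \<delta> \<noteq> 0}"
proof (rule bdd_aboveI)
  fix q assume "q \<in> {(pred_norm x \<delta>)\<^sup>2 / (norm \<delta>)\<^sup>2 | \<delta>. l0norm (restr (- T) \<delta>) \<le> m \<and> \<delta> \<noteq> 0}"
  then obtain \<delta> where q: "q = (pred_norm x \<delta>)\<^sup>2 / (norm \<delta>)\<^sup>2" and "\<delta> \<noteq> 0" by auto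
  have "(x i \<bullet> \<delta>)\<^sup>2 \<le> (norm (x i))\<^sup>2 * (norm \<delta>)\<^sup>2" for i
    using Cauchy_Schwarz_ineq[of "x i" \<delta>] by (simp add: power2_norm_eq_inner)
  then have "En (\<lambda>i. (x i \<bullet> \<delta>)\<^sup>2) \<le> En (\<lambda>i. (norm (x i))\<^sup>2) * (norm \<delta>)\<^sup>2"
    by (simp add: En_real divide_right_mono sum_mono sum_distrib_right)
  then show "q \<le> En (\<lambda>i. (norm (x i))\<^sup>2)"
    using \<open>\<delta> \<noteq> 0\<close> by (simp add: q pred_norm_power2 divide_le_eq)
qed

lemma pred_norm_le_sparse_eigenvalue:
  assumes "l0norm (restr (- T) \<delta>) \<le> m"
  shows "(pred_norm x \<delta>)\<^sup>2 \<le> sparse_eigenvalue x T m * (norm \<delta>)\<^sup>2"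
proof (cases "\<delta> = 0")
  case True
  then show ?thesis by (simp add: pred_norm_power2 En_real)
next
  case False
  have "(pred_norm x \<delta>)\<^sup>2 / (norm \<delta>)\<^sup>2 \<le> sparse_eigenvalue x T m"
    unfolding sparse_eigenvalue_def
    by (rule cSup_upper[OF _ sparse_eigenvalue_bdd]) (use assms False in auto)
  then show ?thesis using False by (simp add: divide_le_eq)
qed

text \<open>A coordinate vector inside \<open>T\<close> satisfies every sparsity bound, even
  \<open>m = 0\<close>.\<close>

lemma admissible_direction_exists:
  fixes T :: "'p::finite set"
  assumes "T \<noteq> {}"
  shows "\<exists>\<delta> :: real ^ 'p. l0norm (restr (- T) \<delta>) \<le> m \<and> \<delta> \<noteq> 0"
proof -
  obtain j where "j \<in> T" using assms by auto
  then have "restr (- T) (axis j (1::real)) = 0"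
    by (auto simp: restr_def vec_eq_iff axis_def)
  then show ?thesis
    by (intro exI[of _ "axis j 1"]) (simp add: axis_eq_0_iff)
qed

lemma sparse_eigenvalue_nonneg:
  assumes "T \<noteq> {}"
  shows "0 \<le> sparse_eigenvalue x T m"
proof -
  obtain \<delta> where \<delta>: "l0norm (restr (- T) \<delta>) \<le> m" "\<delta> \<noteq> 0"
    using admissible_direction_exists[OF assms] by blast
  from pred_norm_le_sparse_eigenvalue[OF \<delta>(1), of x]
  have "0 \<le> sparse_eigenvalue x T m * (norm \<delta>)\<^sup>2"
    by (rule order_trans[rotated]) simp
  then show ?thesis using \<delta>(2) by (simp add: zero_le_mult_iff)
qed

text \<open>Sublinearity of the sparse eigenvalue for vectors living off \<open>T\<close>: cut the
  support into \<open>k\<close> blocks of at most \<open>m\<close> coordinates, then combine the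
  triangle inequality over the blocks with Cauchy--Schwarz. The induction peels off one block at a
  time.\<close>

lemma pred_norm_blocks:
  assumes "supp v \<inter> T = {}" "card (supp v) \<le> k * m" "T \<noteq> {}"
  shows "pred_norm x v \<le> sqrt (real k * sparse_eigenvalue x T m) * norm v"
  using assms
proof (induction k arbitrary: v)
  case 0
  then have "v = 0" by (auto simp: supp_def vec_eq_iff)
  then show ?case by (simp add: pred_norm_def En_real)
next
  case (Suc k)
  let ?\<phi> = "sparse_eigenvalue x T m"
  \<comment> \<open>The minimum covers a last block with fewer than \<open>m\<close> coordinates
    left.\<close>
  have "\<exists>B\<subseteq>supp v. card B = min m (card (supp v))"
    by (rule obtain_subset_with_card_n[of "min m (card (supp v))" "supp v"]) auto
  then obtain B where B: "B \<subseteq> supp v" "card B = min m (card (supp v))" by blast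
  let ?a = "restr B v" and ?b = "restr (- B) v"
  have "l0norm (restr (- T) ?a) \<le> card B"
    unfolding l0norm_def supp_restr by (rule card_mono) auto
  then have "(pred_norm x ?a)\<^sup>2 \<le> ?\<phi> * (norm ?a)\<^sup>2"
    by (intro pred_norm_le_sparse_eigenvalue) (use B in simp)
  then have a: "pred_norm x ?a \<le> sqrt ?\<phi> * norm ?a"
    by (metis real_sqrt_le_mono real_sqrt_mult real_sqrt_abs abs_of_nonneg pred_norm_nonneg
        norm_ge_zero)
  have "supp ?b = supp v - B" by (auto simp: supp_restr)
  then have "card (supp ?b) = card (supp v) - card B"
    using B by (simp add: card_Diff_subset)
  then have "card (supp ?b) \<le> k * m" using B Suc.prems by auto
  then have b: "pred_norm x ?b \<le> sqrt (real k * ?\<phi>) * norm ?b"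
    using Suc.prems by (intro Suc.IH) (auto simp: supp_restr)
  \<comment> \<open>Cauchy--Schwarz for \<open>(1, sqrt k)\<close> against the norms of the two
    orthogonal pieces; the square in the first line of the proof is exactly its defect.\<close>
  have cs: "norm ?a + sqrt (real k) * norm ?b \<le> sqrt (real (Suc k)) * norm v"
  proof (rule power2_le_imp_le)
    have "0 \<le> (sqrt (real k) * norm ?a - norm ?b)\<^sup>2" by simp
    then have "(norm ?a + sqrt (real k) * norm ?b)\<^sup>2
        \<le> real (Suc k) * ((norm ?a)\<^sup>2 + (norm ?b)\<^sup>2)"
      by (simp add: power2_sum power2_diff power_mult_distrib algebra_simps)
    then show "(norm ?a + sqrt (real k) * norm ?b)\<^sup>2 \<le> (sqrt (real (Suc k)) * norm v)\<^sup>2"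
      by (simp add: norm_restr_power2 power_mult_distrib)
  qed simp
  have "pred_norm x v \<le> pred_norm x ?a + pred_norm x ?b"
    using pred_norm_add_le[of x ?a ?b] by (simp add: restr_add_restr)
  also have "\<dots> \<le> sqrt ?\<phi> * (norm ?a + sqrt (real k) * norm ?b)"
    using a b by (simp add: real_sqrt_mult algebra_simps)
  also have "\<dots> \<le> sqrt ?\<phi> * (sqrt (real (Suc k)) * norm v)"
    using cs sparse_eigenvalue_nonneg[OF Suc.prems(3), of x m] by (intro mult_left_mono) auto
  finally show ?case by (simp add: real_sqrt_mult mult_ac)
qed

text \<open>In this multiplied-out form a vanishing denominator is harmless. The quotients are
  bounded below by 0, so their infimum is at most the one for \<open>\<delta>\<close>.\<close>

lemma restricted_eigenvalue_le:
  assumes "l1norm (restr (- T) \<delta>) \<le> C * l1norm (restr T \<delta>)"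
  shows "restricted_eigenvalue x T s C * l1norm (restr T \<delta>) \<le> sqrt (real s) * pred_norm x \<delta>"
proof (cases "l1norm (restr T \<delta>) = 0")
  case False
  then have "\<delta> \<noteq> 0" by (auto simp: l1norm_restr)
  have "restricted_eigenvalue x T s C \<le> sqrt (real s) * pred_norm x \<delta> / l1norm (restr T \<delta>)"
    unfolding restricted_eigenvalue_def
    by (rule cInf_lower) (use assms \<open>\<delta> \<noteq> 0\<close> in \<open>auto intro!: bdd_belowI[of _ 0]\<close>)
  moreover have "0 < l1norm (restr T \<delta>)" using False l1norm_nonneg[of "restr T \<delta>"] by linarith
  ultimately show ?thesis by (simp add: le_divide_eq)
qed simp

section \<open>First-order optimality of the Lasso on its support\<close>

text \<open>The quadratic has a local minimum at 0, where its derivative is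
  \<open>A\<close>.\<close>

lemma linear_coeff_zero:
  fixes A B r :: real
  assumes "r > 0" and nonneg: "\<And>t. \<bar>t\<bar> \<le> r \<Longrightarrow> 0 \<le> A * t + B * t\<^sup>2"
  shows "A = 0"
proof (rule DERIV_local_min)
  show "((\<lambda>t. A * t + B * t\<^sup>2) has_real_derivative A) (at 0)"
    by (auto intro!: derivative_eq_intros)
  show "\<forall>t. \<bar>0 - t\<bar> < r \<longrightarrow> A * 0 + B * 0\<^sup>2 \<le> A * t + B * t\<^sup>2"
    using nonneg by auto
qed fact

text \<open>A perturbation this small cannot carry \<open>a\<close> across zero, so the absolute
  value stays affine. Equality is allowed, so a coordinate may be moved all the way to zero.\<close>

lemma abs_add_small:
  fixes a h :: real
  assumes "\<bar>h\<bar> \<le> \<bar>a\<bar>"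
  shows "\<bar>a + h\<bar> = \<bar>a\<bar> + sgn a * h"
  using assms by (auto simp: sgn_if abs_if split: if_splits)

lemma l1norm_add_small:
  assumes "\<And>j. \<bar>t * v $ j\<bar> \<le> \<bar>b $ j\<bar>"
  shows "l1norm (b + t *\<^sub>R v) = l1norm b + t * (\<Sum>j\<in>UNIV. sgn (b $ j) * v $ j)"
proof -
  have "l1norm (b + t *\<^sub>R v) = (\<Sum>j\<in>UNIV. \<bar>b $ j\<bar> + t * (sgn (b $ j) * v $ j))"
    unfolding l1norm_def using abs_add_small[OF assms] by (intro sum.cong) (auto simp: mult_ac)
  then show ?thesis by (simp add: l1norm_def sum.distrib sum_distrib_left)
qed

lemma small_step_exists:
  fixes b v :: "real ^ 'p::finite"
  assumes "supp v \<subseteq> supp b" "v \<noteq> 0"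
  obtains j where "v $ j \<noteq> 0" "b $ j \<noteq> 0" "\<And>k. \<bar>b $ j / v $ j * v $ k\<bar> \<le> \<bar>b $ k\<bar>"
proof -
  let ?g = "\<lambda>j. \<bar>b $ j / v $ j\<bar>"
  have ne: "supp v \<noteq> {}" using assms(2) by (auto simp: supp_def vec_eq_iff)
  \<comment> \<open>Ratio test: the step of least modulus that annihilates a coordinate carries no
    other coordinate across zero.\<close>
  define j where "j = arg_min_on ?g (supp v)"
  have j: "j \<in> supp v" and least: "\<And>k. k \<in> supp v \<Longrightarrow> ?g j \<le> ?g k"
    unfolding j_def using ne by (auto intro: arg_min_if_finite(1) arg_min_least)
  show ?thesis
  proof
    show "v $ j \<noteq> 0" "b $ j \<noteq> 0" using j assms(1) by (auto simp: supp_def)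
    show "\<bar>b $ j / v $ j * v $ k\<bar> \<le> \<bar>b $ k\<bar>" for k
    proof (cases "v $ k = 0")
      case False
      then have "?g j \<le> \<bar>b $ k\<bar> / \<bar>v $ k\<bar>" using least[of k] by (simp add: supp_def)
      then show ?thesis using False by (simp add: abs_mult le_divide_eq)
    qed simp
  qed
qed

text \<open>Along a direction inside the support of \<open>b\<close> the penalty is affine for small
  steps. The objective is then a quadratic in the step \<open>t\<close>, minimal at 0, and its
  linear coefficient vanishes.\<close>

lemma lasso_first_order:
  fixes x :: "'n::finite \<Rightarrow> real ^ 'p::finite"
  assumes min: "\<And>b'. lasso_objective x y lam b \<le> lasso_objective x y lam b'"
    and v: "supp v \<subseteq> supp b"
  shows "2 * En (\<lambda>i. (y i - x i \<bullet> b) * (x i \<bullet> v))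
       = lam / real CARD('n) * (\<Sum>j\<in>UNIV. sgn (b $ j) * v $ j)"
proof (cases "v = 0")
  case False
  obtain j where j: "v $ j \<noteq> 0" "b $ j \<noteq> 0" "\<And>k. \<bar>b $ j / v $ j * v $ k\<bar> \<le> \<bar>b $ k\<bar>"
    using small_step_exists[OF v False] by metis
  let ?G = "2 * En (\<lambda>i. (y i - x i \<bullet> b) * (x i \<bullet> v))"
  let ?H = "lam / real CARD('n) * (\<Sum>j\<in>UNIV. sgn (b $ j) * v $ j)"
  have "?H - ?G = 0"
  proof (rule linear_coeff_zero)
    show "0 < \<bar>b $ j / v $ j\<bar>" using j by simp
    fix t :: real assume t: "\<bar>t\<bar> \<le> \<bar>b $ j / v $ j\<bar>"
    have "\<bar>t * v $ k\<bar> \<le> \<bar>b $ k\<bar>" for k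
      using order_trans[OF mult_right_mono[OF t, of "\<bar>v $ k\<bar>"]] j(3)[of k] by (simp add: abs_mult)
    then have "l1norm (b + t *\<^sub>R v) = l1norm b + t * (\<Sum>j\<in>UNIV. sgn (b $ j) * v $ j)"
      by (rule l1norm_add_small)
    moreover have "(pred_norm x (t *\<^sub>R v))\<^sup>2 = (pred_norm x v)\<^sup>2 * t\<^sup>2"
      by (simp add: pred_norm_power2 En_real power_mult_distrib sum_distrib_left mult_ac)
    moreover have "2 * En (\<lambda>i. (y i - x i \<bullet> b) * (x i \<bullet> (t *\<^sub>R v))) = t * ?G"
      by (simp add: En_real sum_distrib_left mult_ac)
    ultimately show "0 \<le> (?H - ?G) * t + (pred_norm x v)\<^sup>2 * t\<^sup>2"
      using min[of "b + t *\<^sub>R v"] by (simp add: lasso_objective_def Qhat_add algebra_simps)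
  qed
  then show ?thesis by simp
qed (simp add: En_real)

section \<open>The Lasso support has at most \<open>n\<close> elements\<close>

text \<open>Dimension count: the design vectors restricted to \<open>A\<close> span at most
  \<open>n\<close> dimensions inside a coordinate subspace of dimension \<open>card A\<close>. Some
  nonzero vector of that subspace is orthogonal to them all.\<close>

lemma null_direction_exists:
  fixes x :: "'n::finite \<Rightarrow> real ^ 'p::finite"
  assumes "CARD('n) < card A"
  obtains v where "v \<noteq> 0" "supp v \<subseteq> A" "\<And>i. x i \<bullet> v = 0"
proof -
  define E where "E = (\<lambda>j. axis j (1::real)) ` A"
  define S where "S = range (\<lambda>i. restr A (x i))"
  have inE: "w \<in> span E \<longleftrightarrow> supp w \<subseteq> A" for w :: "real ^ 'p"
  proof
    assume "w \<in> span E"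
    then show "supp w \<subseteq> A"
    proof (induction rule: span_induct_alt)
      case (step c e w)
      then show ?case by (auto simp: E_def supp_def axis_def split: if_splits)
    qed (simp add: supp_def)
  next
    assume w: "supp w \<subseteq> A"
    have "w = (\<Sum>j\<in>UNIV. w $ j *\<^sub>R axis j 1)"
      using basis_expansion[of w] by (simp add: scalar_mult_eq_scaleR)
    also have "\<dots> \<in> span E"
    proof (intro span_sum)
      fix j show "w $ j *\<^sub>R axis j 1 \<in> span E"
        using w by (cases "w $ j = 0") (auto simp: E_def supp_def intro!: span_base span_scale span_zero)
    qed
    finally show "w \<in> span E" .
  qed
  have "dim E = card E"
    by (rule dim_eq_card_independent, rule independent_mono[OF independent_Basis])
       (auto simp: E_def axis_in_Basis_iff)
  moreover have "card E = card A"
    unfolding E_def by (rule card_image) (auto simp: inj_on_def axis_eq_axis)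
  moreover have "dim S \<le> CARD('n)"
    unfolding S_def by (rule order_trans[OF dim_le_card' card_image_le]) auto
  moreover have sub: "span S \<subseteq> span E"
    by (rule span_minimal) (auto simp: S_def inE supp_restr)
  ultimately have "span S \<noteq> span E" by (metis assms dim_span leD)
  with sub have "span S \<subset> span E" by blast
  then obtain v where v: "v \<noteq> 0" "v \<in> span E" "\<And>w. w \<in> span S \<Longrightarrow> orthogonal v w"
    using orthogonal_to_subspace_exists_gen by metis
  have suppv: "supp v \<subseteq> A" using v(2) inE by simp
  have "x i \<bullet> v = restr A (x i) \<bullet> v" for i
    unfolding inner_vec_def using suppv by (intro sum.cong) (auto simp: restr_def supp_def)
  then have "x i \<bullet> v = 0" for i
    using v(3)[OF span_base, of "restr A (x i)"] by (simp add: S_def orthogonal_def inner_commute)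
  then show ?thesis using v(1) suppv that by blast
qed

lemma lasso_is_minimizer:
  "is_lasso x y lam b \<Longrightarrow> lasso_objective x y lam b \<le> lasso_objective x y lam b'"
  by (auto simp: is_lasso_def is_arg_min_def not_less)

lemma lasso_card_supp_le:
  fixes x :: "'n::finite \<Rightarrow> real ^ 'p::finite"
  assumes lasso: "is_lasso x y lam b" and lam: "lam > 0"
  shows "card (supp b) \<le> CARD('n)"
proof (rule ccontr)
  assume "\<not> ?thesis"
  then obtain v where v: "v \<noteq> 0" "supp v \<subseteq> supp b" "\<And>i. x i \<bullet> v = 0"
    using null_direction_exists[of "supp b" x] by (metis not_less)
  obtain j where j: "v $ j \<noteq> 0" "b $ j \<noteq> 0" "\<And>k. \<bar>b $ j / v $ j * v $ k\<bar> \<le> \<bar>b $ k\<bar>"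
    using small_step_exists[OF v(2,1)] by metis
  note min = lasso_is_minimizer[OF lasso]
  \<comment> \<open>The fit does not change along \<open>v\<close>, so the first-order condition
    with \<open>lam > 0\<close> makes the penalty stationary as well.\<close>
  have slope: "(\<Sum>j\<in>UNIV. sgn (b $ j) * v $ j) = 0"
    using lasso_first_order[OF min v(2)] lam by (simp add: v(3) En_real)
  \<comment> \<open>The sign is chosen so that coordinate \<open>j\<close> becomes zero.\<close>
  define b' where "b' = b + (- (b $ j / v $ j)) *\<^sub>R v"
  have "l1norm b' = l1norm b"
    unfolding b'_def by (subst l1norm_add_small) (use j(3) slope in auto)
  moreover have "Qhat x y b' = Qhat x y b"
    unfolding b'_def Qhat_def by (simp add: inner_add_right inner_diff_right v(3))
  ultimately have "lasso_objective x y lam b' = lasso_objective x y lam b"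
    by (simp add: lasso_objective_def)
  then have "is_arg_min (lasso_objective x y lam) (\<lambda>_. True) b'"
    using min by (auto simp: is_arg_min_def not_less)
  \<comment> \<open>The tie-breaking rule of minimal support enters here: \<open>b'\<close> is
    another minimizer.\<close>
  then have "l0norm b \<le> l0norm b'"
    using lasso by (auto simp: is_lasso_def is_arg_min_def not_less)
  moreover have "supp b' \<subset> supp b"
  proof (rule psubsetI)
    show "supp b' \<subseteq> supp b" using v(2) by (auto simp: b'_def supp_def)
    have "j \<in> supp b" "j \<notin> supp b'" using j by (auto simp: b'_def supp_def)
    then show "supp b' \<noteq> supp b" by auto
  qed
  then have "l0norm b' < l0norm b" unfolding l0norm_def by (intro psubset_card_mono) auto
  ultimately show False by simp
qed

section \<open>The oracle dimension and the oracle vector\<close>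

lemma oracle_dim_is_arg_min:
  fixes x :: "'n::finite \<Rightarrow> real ^ 'p::finite"
  shows "is_arg_min (oracle_risk x f \<sigma>) (\<lambda>k. k \<le> min CARD('p) CARD('n)) (oracle_dim x f \<sigma>)"
proof -
  have "\<exists>k. is_arg_min (oracle_risk x f \<sigma>) (\<lambda>k. k \<in> {..min CARD('p) CARD('n)}) k"
    by (rule ex_is_arg_min_if_finite) auto
  then show ?thesis unfolding oracle_dim_def atMost_iff by (rule LeastI_ex)
qed

lemma approx_err_eq:
  assumes "is_arg_min (Qhat x f) (\<lambda>b. l0norm b \<le> k) b"
  shows "approx_err x f k = sqrt (Qhat x f b)"
proof -
  have "(INF b\<in>{b. l0norm b \<le> k}. Qhat x f b) = Qhat x f b"
    using assms by (intro cInf_eq_minimum) (auto simp: is_arg_min_def not_less)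
  then show ?thesis by (simp add: approx_err_def)
qed

text \<open>If the oracle vector were zero, dimension 0 would attain the same approximation error
  with no larger penalty. The least minimizer of the risk would then be 0. This makes
  \<open>T\<close> nonempty.\<close>

lemma oracle_minimizer_nonzero:
  assumes s: "s = oracle_dim x f \<sigma>" "s \<ge> 1"
    and b: "is_arg_min (Qhat x f) (\<lambda>b. l0norm b \<le> s) b"
  shows "b \<noteq> 0"
proof
  assume "b = 0"
  have "is_arg_min (Qhat x f) (\<lambda>b. l0norm b \<le> 0) 0"
    by (auto simp: is_arg_min_def l0norm_eq_0_iff)
  then have "approx_err x f 0 = approx_err x f s"
    using approx_err_eq[OF b] approx_err_eq[of x f 0 0] \<open>b = 0\<close> by simp
  then have "oracle_risk x f \<sigma> 0 \<le> oracle_risk x f \<sigma> s" by (simp add: oracle_risk_def)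
  then have "is_arg_min (oracle_risk x f \<sigma>) (\<lambda>k. k \<le> min CARD('b) CARD('a)) 0"
    using oracle_dim_is_arg_min[of x f \<sigma>] unfolding s(1)[symmetric]
    by (force simp: is_arg_min_def not_less)
  then have "oracle_dim x f \<sigma> \<le> 0" unfolding oracle_dim_def by (rule Least_le)
  with s show False by simp
qed

section \<open>Prediction error of the Lasso\<close>

text \<open>Off \<open>T\<close> the oracle vector vanishes, so there the l1 norm of the error is
  that of \<open>b\<close> itself; on \<open>T\<close> the triangle inequality applies.\<close>

lemma l1norm_cone_diff:
  assumes "T = supp b0"
  shows "l1norm b0 - l1norm b \<le> l1norm (restr T (b - b0)) - l1norm (restr (- T) (b - b0))"
proof -
  have zero: "b0 $ j = 0" if "j \<notin> T" for j using that assms by (simp add: supp_def)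
  have "l1norm b0 = l1norm (restr T b0)"
    using l1norm_split[of b0 T] by (simp add: l1norm_restr zero)
  moreover have "l1norm (restr (- T) (b - b0)) = l1norm (restr (- T) b)"
    by (simp add: l1norm_restr zero)
  moreover have "l1norm (restr T b0) - l1norm (restr T b) \<le> l1norm (restr T (b - b0))"
    unfolding l1norm_restr sum_subtractf[symmetric] by (rule sum_mono) simp
  ultimately show ?thesis using l1norm_split[of b T] by linarith
qed

text \<open>Splits minus the directional derivative of the loss into the noise part, seen only
  through the score, and the deterministic part.\<close>

lemma residual_En:
  fixes x :: "'n::finite \<Rightarrow> real ^ 'p::finite"
  assumes y: "\<And>i. y i = f i + e i"
  shows "2 * En (\<lambda>i. (y i - x i \<bullet> b) * (x i \<bullet> v))
    = score x e \<bullet> v + 2 * En (\<lambda>i. (f i - x i \<bullet> b) * (x i \<bullet> v))"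
  unfolding inner_score by (simp add: y En_real algebra_simps sum.distrib sum_subtractf
      add_divide_distrib diff_divide_distrib)

lemma lasso_pred_norm_le:
  fixes x :: "'n::finite \<Rightarrow> real ^ 'p::finite"
  assumes y: "\<And>i. y i = f i + e i"
    and min: "lasso_objective x y lam b \<le> lasso_objective x y lam b0"
    and T: "T = supp b0"
    and c: "c > 1" and lam: "lam > 0"
    and kappa: "\<kappa> = restricted_eigenvalue x T s ((c + 1) / (c - 1))" "\<kappa> > 0"
    and event: "c * real CARD('n) * infnorm (score x e) \<le> lam"
  shows "pred_norm x (b - b0)
    \<le> (1 + 1 / c) * lam * sqrt (real s) / (real CARD('n) * \<kappa>) + 2 * sqrt (Qhat x f b0)"
proof -
  define d where "d = b - b0"
  define N where "N = pred_norm x d"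
  define r where "r = sqrt (Qhat x f b0)"
  define \<mu> where "\<mu> = lam / real CARD('n)"
  define U where "U = l1norm (restr T d)"
  define V where "V = l1norm (restr (- T) d)"
  have pos: "0 < \<mu>" "0 \<le> N" "0 \<le> r" "0 \<le> U" "0 \<le> V"
    using lam by (simp_all add: \<mu>_def N_def r_def U_def V_def Qhat_nonneg)
  have S: "infnorm (score x e) \<le> \<mu> / c"
    using event c by (simp add: \<mu>_def le_divide_eq mult_ac)
  have "score x e \<bullet> d \<le> infnorm (score x e) * l1norm d"
    using abs_inner_le_infnorm_l1norm[of "score x e" d] by linarith
  also have "\<dots> \<le> \<mu> / c * (U + V)"
    unfolding U_def V_def l1norm_split[of d T, symmetric] by (intro mult_right_mono S) simp
  finally have noise: "score x e \<bullet> d \<le> \<mu> / c * (U + V)" .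
  have approx: "En (\<lambda>i. (f i - x i \<bullet> b0) * (x i \<bullet> d)) \<le> r * N"
    using abs_En_mult_le[of "\<lambda>i. f i - x i \<bullet> b0" "\<lambda>i. x i \<bullet> d"]
    by (simp add: r_def N_def Qhat_def pred_norm_def)
  have "N\<^sup>2 \<le> 2 * En (\<lambda>i. (y i - x i \<bullet> b0) * (x i \<bullet> d)) + \<mu> * (l1norm b0 - l1norm b)"
    using min Qhat_add[of x y b0 d] unfolding lasso_objective_def d_def N_def \<mu>_def
    by (simp add: right_diff_distrib)
  also have "\<dots> \<le> \<mu> / c * (U + V) + 2 * (r * N) + \<mu> * (U - V)"
    unfolding residual_En[of y f e, OF y] U_def V_def d_def
    using noise approx mult_left_mono[OF l1norm_cone_diff[OF T, of b], of \<mu>] pos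
    unfolding U_def V_def d_def by linarith
  \<comment> \<open>The noise costs at most \<open>\<mu> / c\<close> times each l1 part; the penalty
    adds \<open>\<mu> * U\<close> and gains \<open>\<mu> * V\<close>.\<close>
  finally have basic: "N\<^sup>2 \<le> \<mu> * ((1 + 1 / c) * U - (1 - 1 / c) * V) + 2 * r * N"
    by (simp add: algebra_simps add_divide_distrib)
  \<comment> \<open>The case split is at the cone on which \<open>(1 - 1 / c) * V\<close> is at most
    \<open>(1 + 1 / c) * U\<close>. Inside it the restricted eigenvalue bounds \<open>U\<close> by
    \<open>N\<close>; outside it the l1 terms of \<open>basic\<close> are nonpositive.\<close>
  have "N \<le> (1 + 1 / c) * \<mu> * sqrt (real s) / \<kappa> + 2 * r"
  proof (cases "V \<le> (c + 1) / (c - 1) * U")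
    case True
    then have "\<kappa> * U \<le> sqrt (real s) * N"
      unfolding kappa(1) U_def V_def N_def by (rule restricted_eigenvalue_le)
    then have U: "U \<le> sqrt (real s) * N / \<kappa>" using kappa(2) by (simp add: le_divide_eq mult_ac)
    have "0 \<le> (1 - 1 / c) * V" using c pos by simp
    with basic have "N\<^sup>2 \<le> \<mu> * ((1 + 1 / c) * U) + 2 * r * N"
      using mult_left_mono[of "(1 + 1 / c) * U - (1 - 1 / c) * V" "(1 + 1 / c) * U" \<mu>] pos
      by linarith
    also have "\<dots> \<le> \<mu> * ((1 + 1 / c) * (sqrt (real s) * N / \<kappa>)) + 2 * r * N"
      using U pos c by (intro add_right_mono mult_left_mono) auto
    finally have "N * N \<le> ((1 + 1 / c) * \<mu> * sqrt (real s) / \<kappa> + 2 * r) * N"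
      by (simp add: power2_eq_square algebra_simps)
    then show ?thesis
      using pos c kappa(2) by (cases "N = 0") (auto simp: mult_le_cancel_right)
  next
    case False
    then have "(c + 1) * U / c \<le> (c - 1) * V / c"
      using c by (intro divide_right_mono) (auto simp: not_le pos_divide_less_eq mult_ac)
    then have "(1 + 1 / c) * U \<le> (1 - 1 / c) * V" using c by (simp add: field_simps)
    then have "\<mu> * ((1 + 1 / c) * U - (1 - 1 / c) * V) \<le> 0"
      using pos by (simp add: mult_le_0_iff)
    with basic have "N * N \<le> 2 * r * N" by (simp add: power2_eq_square)
    then have "N \<le> 2 * r" using pos by (cases "N = 0") (auto simp: mult_le_cancel_right)
    moreover have "0 \<le> (1 + 1 / c) * \<mu> * sqrt (real s) / \<kappa>" using pos c kappa(2) by simp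
    ultimately show ?thesis by linarith
  qed
  then show ?thesis by (simp add: N_def d_def r_def \<mu>_def mult_ac)
qed

section \<open>Sparsity of the Lasso\<close>

text \<open>The bound \<open>K\<close> on the quadratic form is left open, so that it can later be
  taken as a multiple of a sparse eigenvalue.\<close>

lemma lasso_presparsity:
  fixes x :: "'n::finite \<Rightarrow> real ^ 'p::finite"
  assumes y: "\<And>i. y i = f i + e i"
    and min: "\<And>b'. lasso_objective x y lam b \<le> lasso_objective x y lam b'"
    and T: "T = supp b0"
    and s: "s \<ge> 1"
    and c: "c > 1" and lam: "lam > 0"
    and cbar: "cbar = (c + 1) / (c - 1)"
    and kappa: "\<kappa> = restricted_eigenvalue x T s cbar" "\<kappa> > 0"
    and event: "c * real CARD('n) * infnorm (score x e) \<le> lam"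
    and r: "r = sqrt (Qhat x f b0)"
    and K: "0 \<le> K" "\<And>v. supp v \<subseteq> supp b - T \<Longrightarrow> pred_norm x v \<le> sqrt K * norm v"
  shows "real (card (supp b - T)) \<le> real s * K *
    (2 * cbar / \<kappa> + 3 * (cbar + 1) * (real CARD('n) * r / (lam * sqrt (real s))))\<^sup>2"
proof -
  define A where "A = supp b - T"
  define m where "m = real (card A)"
  define n where "n = real CARD('n)"
  define \<mu> where "\<mu> = lam / n"
  define d where "d = b - b0"
  define N where "N = pred_norm x d"
  define v :: "real ^ 'p" where "v = (\<chi> j. if j \<in> A then sgn (b $ j) else 0)"
  have n0: "n > 0" by (simp add: n_def)
  then have pos: "\<mu> > 0" "0 \<le> N" "0 \<le> r" "0 \<le> m" "sqrt (real s) > 0"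
    using lam s by (simp_all add: \<mu>_def N_def r m_def Qhat_nonneg)
  have suppv: "supp v \<subseteq> A" by (auto simp: v_def supp_def)
  have nz: "b $ j \<noteq> 0" if "j \<in> A" for j
    using that by (simp add: A_def supp_def)
  \<comment> \<open>The squared norm of \<open>v\<close>, its l1 norm and its pairing with the signs
    of \<open>b\<close> all count the elements of \<open>A\<close>.\<close>
  have count: "(\<Sum>j\<in>UNIV. g j) = m" if "\<And>j. g j = (if j \<in> A then 1 else 0)" for g :: "'p \<Rightarrow> real"
    unfolding that m_def by (simp add: sum.If_cases)
  have sumv: "(\<Sum>j\<in>UNIV. sgn (b $ j) * v $ j) = m"
    by (rule count) (simp add: v_def nz)
  have "(norm v)\<^sup>2 = m"
    unfolding power2_norm_eq_inner inner_vec_def by (rule count) (simp add: v_def nz)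
  then have normv: "norm v = sqrt m" by (metis norm_ge_zero real_sqrt_abs abs_of_nonneg)
  have l1v: "l1norm v = m"
    unfolding l1norm_def by (rule count) (simp add: v_def nz abs_sgn_eq)
  have foc: "2 * En (\<lambda>i. (y i - x i \<bullet> b) * (x i \<bullet> v)) = \<mu> * m"
    using lasso_first_order[OF min, of v] suppv by (auto simp: sumv A_def \<mu>_def n_def)
  have noise: "score x e \<bullet> v \<le> \<mu> / c * m"
  proof -
    have "score x e \<bullet> v \<le> infnorm (score x e) * l1norm v"
      using abs_inner_le_infnorm_l1norm[of "score x e" v] by linarith
    also have "\<dots> \<le> \<mu> / c * m"
      using event c n0 unfolding l1v
      by (intro mult_right_mono) (auto simp: \<mu>_def n_def le_divide_eq mult_ac m_def)
    finally show ?thesis .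
  qed
  \<comment> \<open>The deterministic residual splits into the oracle approximation error and the
    prediction error \<open>x i \<bullet> d\<close>.\<close>
  have "En (\<lambda>i. (f i - x i \<bullet> b) * (x i \<bullet> v))
      = En (\<lambda>i. (f i - x i \<bullet> b0) * (x i \<bullet> v)) - En (\<lambda>i. (x i \<bullet> d) * (x i \<bullet> v))"
    by (simp add: En_real d_def inner_diff_right algebra_simps sum_subtractf sum.distrib
        add_divide_distrib diff_divide_distrib)
  also have "\<dots> \<le> r * pred_norm x v + N * pred_norm x v"
    using abs_En_mult_le[of "\<lambda>i. f i - x i \<bullet> b0" "\<lambda>i. x i \<bullet> v"]
      abs_En_mult_le[of "\<lambda>i. x i \<bullet> d" "\<lambda>i. x i \<bullet> v"]
    unfolding r N_def Qhat_def pred_norm_def by linarith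
  also have "\<dots> = (N + r) * pred_norm x v" by (simp add: algebra_simps)
  also have "\<dots> \<le> (N + r) * (sqrt K * sqrt m)"
    using K(2)[of v] suppv pos by (intro mult_left_mono) (auto simp: A_def normv)
  finally have "\<mu> * m \<le> \<mu> / c * m + 2 * ((N + r) * (sqrt K * sqrt m))"
    using foc noise residual_En[of y f e x b v, OF y] by linarith
  \<comment> \<open>Writing \<open>m\<close> as \<open>sqrt m * sqrt m\<close> allows one factor to
    be cancelled.\<close>
  then have "\<mu> * (1 - 1 / c) * sqrt m * sqrt m \<le> 2 * (N + r) * sqrt K * sqrt m"
    using pos(4) by (simp add: algebra_simps)
  then have main: "\<mu> * (1 - 1 / c) * sqrt m \<le> 2 * (N + r) * sqrt K"
    using pos K(1) by (cases "m = 0") (auto simp: mult_le_cancel_right)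
  have "N \<le> (1 + 1 / c) * lam * sqrt (real s) / (n * \<kappa>) + 2 * r"
    unfolding N_def d_def r n_def
    by (rule lasso_pred_norm_le[of y f e x lam b b0 T c \<kappa> s])
       (use y min T c lam kappa cbar event in auto)
  \<comment> \<open>The constant 3 arises here: \<open>2 * r\<close> from the prediction bound and
    one more \<open>r\<close> from the approximation error.\<close>
  then have N: "N + r \<le> (1 + 1 / c) * \<mu> * sqrt (real s) / \<kappa> + 3 * r"
    by (simp add: \<mu>_def mult_ac)
  define R where "R = 2 * cbar / \<kappa> + 3 * (cbar + 1) * (n * r / (lam * sqrt (real s)))"
  have R: "2 * ((1 + 1 / c) * \<mu> * sqrt (real s) / \<kappa> + 3 * r) = \<mu> * (1 - 1 / c) * (sqrt (real s) * R)"
  proof -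
    \<comment> \<open>These two identities turn the factors in \<open>c\<close> into the constants
      of \<open>R\<close>.\<close>
    have 1: "(1 - 1 / c) * cbar = 1 + 1 / c" "(1 - 1 / c) * (cbar + 1) = 2"
      using c by (simp_all add: cbar field_simps)
    have 2: "\<mu> * (sqrt (real s) * (n * r / (lam * sqrt (real s)))) = r"
      using n0 lam pos(5) by (simp add: \<mu>_def)
    have "\<mu> * (1 - 1 / c) * (sqrt (real s) * R)
        = 2 * (((1 - 1 / c) * cbar) * \<mu> * sqrt (real s) / \<kappa>)
          + 3 * ((1 - 1 / c) * (cbar + 1)) * (\<mu> * (sqrt (real s) * (n * r / (lam * sqrt (real s)))))"
      unfolding R_def by (simp only: distrib_left distrib_right times_divide_eq_right mult_ac)
    then show ?thesis unfolding 1 2 by simp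
  qed
  have "\<mu> * (1 - 1 / c) * sqrt m \<le> 2 * (N + r) * sqrt K" by (rule main)
  also have "\<dots> \<le> 2 * ((1 + 1 / c) * \<mu> * sqrt (real s) / \<kappa> + 3 * r) * sqrt K"
    using N K(1) by (intro mult_right_mono) auto
  also have "\<dots> = \<mu> * (1 - 1 / c) * (sqrt (real s) * R * sqrt K)"
    unfolding R by (simp only: mult_ac)
  finally have "sqrt m \<le> sqrt (real s) * R * sqrt K"
    using pos c by (simp add: mult_le_cancel_left)
  then have "(sqrt m)\<^sup>2 \<le> (sqrt (real s) * R * sqrt K)\<^sup>2"
    using pos by (intro power_mono) auto
  then show ?thesis
    using pos K(1) by (simp add: power_mult_distrib m_def A_def R_def n_def mult_ac)
qed

lemma lasso_sparsity:
  fixes x :: "'n::finite \<Rightarrow> real ^ 'p::finite"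
  assumes y: "\<And>i. y i = f i + e i"
    and lasso: "is_lasso x y lam b"
    and T: "T = supp b0" "T \<noteq> {}"
    and s: "s \<ge> 1"
    and c: "c > 1" and lam: "lam > 0"
    and cbar: "cbar = (c + 1) / (c - 1)"
    and kappa: "\<kappa> = restricted_eigenvalue x T s cbar" "\<kappa> > 0"
    and event: "c * real CARD('n) * infnorm (score x e) \<le> lam"
    and r: "r = sqrt (Qhat x f b0)"
    and L: "L = (2 * cbar / \<kappa> + 3 * (cbar + 1) * (real CARD('n) * r / (lam * sqrt (real s))))\<^sup>2"
    and m: "real m > real s * sparse_eigenvalue x T (min m CARD('n)) * (2 * L)"
  shows "real (card (supp b - T)) \<le> real s * sparse_eigenvalue x T (min m CARD('n)) * L"
proof -
  define \<phi> where "\<phi> = sparse_eigenvalue x T (min m CARD('n))"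
  define mh where "mh = card (supp b - T)"
  have \<phi>0: "0 \<le> \<phi>" unfolding \<phi>_def by (rule sparse_eigenvalue_nonneg[OF T(2)])
  have L0: "0 \<le> L" by (simp add: L)
  have m0: "0 < m"
    using m \<phi>0 L0 unfolding \<phi>_def[symmetric]
    by (metis le_less_trans mult_nonneg_nonneg of_nat_0_le_iff of_nat_0_less_iff zero_le_numeral)
  have mhn: "mh \<le> CARD('n)"
    using card_mono[of "supp b" "supp b - T"] lasso_card_supp_le[OF lasso lam]
    by (simp add: mh_def)
  \<comment> \<open>Used twice: with several blocks to refute \<open>m < mh\<close>, and with a
    single block for the conclusion.\<close>
  have presparse: "real mh \<le> real s * (real k * \<phi>) * L" if "mh \<le> k * min m CARD('n)" for k
    unfolding mh_def L
  proof (rule lasso_presparsity[OF y lasso_is_minimizer[OF lasso] T(1) s c lam cbar kappa event r])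
    show "0 \<le> real k * \<phi>" using \<phi>0 by simp
    fix v assume v: "supp v \<subseteq> supp b - T"
    then have "card (supp v) \<le> mh" unfolding mh_def by (intro card_mono) auto
    with v that show "pred_norm x v \<le> sqrt (real k * \<phi>) * norm v"
      unfolding \<phi>_def by (intro pred_norm_blocks T(2)) auto
  qed
  have "mh \<le> m"
  proof (rule ccontr)
    assume less: "\<not> mh \<le> m"
    \<comment> \<open>This may exceed the ceiling of \<open>mh / m\<close> by one, yet
      \<open>m * k \<le> mh + m \<le> 2 * mh\<close>.\<close>
    define k where "k = mh div m + 1"
    have "mh < k * m"
      using dividend_less_div_times[OF m0, of mh] unfolding k_def by (simp add: algebra_simps)
    \<comment> \<open>Since \<open>m < mh \<le> n\<close>, the block size \<open>min m n\<close> is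
      \<open>m\<close> itself.\<close>
    then have "real mh \<le> real s * (real k * \<phi>) * L"
      using less mhn by (intro presparse) (simp add: min_absorb1)
    also have "\<dots> = real k * (real s * \<phi> * L)" by (simp add: mult_ac)
    finally have "real m * real mh \<le> (real m * real k) * (real s * \<phi> * L)"
      by (metis mult.assoc mult_left_mono of_nat_0_le_iff)
    also have "\<dots> \<le> (2 * real mh) * (real s * \<phi> * L)"
    proof (intro mult_right_mono)
      have "m * k \<le> 2 * mh"
        using less times_div_less_eq_dividend[of m mh] unfolding k_def distrib_left by linarith
      then have "real (m * k) \<le> real (2 * mh)" by (rule of_nat_mono)
      then show "real m * real k \<le> 2 * real mh" by simp
    qed (use \<phi>0 L0 in simp)
    also have "\<dots> = (real s * \<phi> * (2 * L)) * real mh" by (simp add: mult_ac)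
    finally have "real m \<le> real s * \<phi> * (2 * L)"
      using less by (simp add: mult_le_cancel_right)
    then show False using m by (simp add: \<phi>_def)
  qed
  then show ?thesis using presparse[of 1] mhn by (simp add: \<phi>_def mh_def)
qed

theorem theorem3:
  fixes M :: "'w measure"
    and z :: "'n::finite \<Rightarrow> 'z"
    and f :: "'z \<Rightarrow> real"
    and P :: "'z \<Rightarrow> real ^ 'p::finite"
    and x :: "'n \<Rightarrow> real ^ 'p"
    and \<epsilon> y :: "'n \<Rightarrow> 'w \<Rightarrow> real"
    and \<sigma> lam c cbar c\<^sub>s \<kappa> L :: real
    and n s :: nat
    and \<phi> :: "nat \<Rightarrow> real"
    and \<beta>\<^sub>0 :: "real ^ 'p"
    and T :: "'p set"
    and \<beta>hat :: "'w \<Rightarrow> real ^ 'p"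
    and \<M> :: "nat set"
  assumes n: "n = CARD('n)"
    and prob: "prob_space M"
    and sigma: "\<sigma> > 0"
    and noise_indep: "prob_space.indep_vars M (\<lambda>_. borel) \<epsilon> UNIV"
    and noise_normal: "\<And>i. distributed M lborel (\<epsilon> i) (normal_density 0 \<sigma>)"
    and response: "\<And>i \<omega>. y i \<omega> = f (z i) + \<epsilon> i \<omega>"
    and regressors: "\<And>i. x i = P (z i)"
    and normalized: "\<And>j. En (\<lambda>i. (x i $ j)\<^sup>2) = 1"
    and s: "s = oracle_dim x (\<lambda>i. f (z i)) \<sigma>" "s \<ge> 1"
    and beta0: "is_arg_min (Qhat x (\<lambda>i. f (z i))) (\<lambda>\<beta>. l0norm \<beta> \<le> s) \<beta>\<^sub>0"
    and T: "T = supp \<beta>\<^sub>0"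
    and c_s: "c\<^sub>s = approx_err x (\<lambda>i. f (z i)) s"
    and c: "c > 1"
    and cbar: "cbar = (c + 1) / (c - 1)"
    and kappa: "\<kappa> = restricted_eigenvalue x T s cbar" "\<kappa> > 0"
    and phi: "\<phi> = sparse_eigenvalue x T"
    and lambda: "lam > 0"
    and lasso: "\<And>\<omega>. \<omega> \<in> space M \<Longrightarrow> is_lasso x (\<lambda>i. y i \<omega>) lam (\<beta>hat \<omega>)"
    and L: "L = (2 * cbar / \<kappa> + 3 * (cbar + 1) * (real n * c\<^sub>s / (lam * sqrt (real s))))\<^sup>2"
    and M_set: "\<M> = {m. real m > real s * \<phi> (min m n) * (2 * L)}"
  shows "{\<omega> \<in> space M. lam \<ge> c * real n * infnorm (score x (\<lambda>i. \<epsilon> i \<omega>))}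
       \<subseteq> {\<omega> \<in> space M. real (card (supp (\<beta>hat \<omega>) - T))
                       \<le> real s * Min ((\<lambda>m. \<phi> (min m n)) ` \<M>) * L}"
proof (intro subsetI CollectI conjI; elim CollectE conjE)
  fix \<omega> assume \<omega>: "\<omega> \<in> space M"
    and event: "lam \<ge> c * real n * infnorm (score x (\<lambda>i. \<epsilon> i \<omega>))"
  have T_ne: "T \<noteq> {}"
    using oracle_minimizer_nonzero[OF s beta0] by (auto simp: T supp_def vec_eq_iff)
  have r: "c\<^sub>s = sqrt (Qhat x (\<lambda>i. f (z i)) \<beta>\<^sub>0)"
    unfolding c_s by (rule approx_err_eq[OF beta0])
  \<comment> \<open>Capping at \<open>n\<close> leaves finitely many values, so \<open>Min\<close>
    is a true minimum although \<open>\<M>\<close> is unbounded.\<close>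
  have "(\<lambda>m. \<phi> (min m n)) ` \<M> \<subseteq> \<phi> ` {..n}" by auto
  then have fin: "finite ((\<lambda>m. \<phi> (min m n)) ` \<M>)" by (rule finite_subset) simp
  \<comment> \<open>From \<open>n\<close> on the threshold defining \<open>\<M>\<close> is constant,
    so every large enough index belongs to \<open>\<M>\<close>.\<close>
  obtain k :: nat where "real k > real s * \<phi> n * (2 * L)" using reals_Archimedean2 by blast
  then have "max k n \<in> \<M>" unfolding M_set by (simp add: min_absorb2)
  then have "Min ((\<lambda>m. \<phi> (min m n)) ` \<M>) \<in> (\<lambda>m. \<phi> (min m n)) ` \<M>"
    by (intro Min_in fin) auto
  then obtain m where m: "m \<in> \<M>" "Min ((\<lambda>m. \<phi> (min m n)) ` \<M>) = \<phi> (min m n)" by auto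
  show "real (card (supp (\<beta>hat \<omega>) - T)) \<le> real s * Min ((\<lambda>m. \<phi> (min m n)) ` \<M>) * L"
    unfolding m(2) unfolding phi n
    by (rule lasso_sparsity[OF response lasso[OF \<omega>] T T_ne s(2) c lambda cbar kappa _ r])
       (use event L m(1) in \<open>auto simp: n M_set phi\<close>)
qed

end
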